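(* For all integers $d \geq 1$, $p \geq 2$, and $n \geq 1$ we have \[ C_{d,p}(n) = \frac{1}{n} \sum_{t_1, \ldots, t_d} \left[ \binom{ n - 1 + t_1 + \cdots + t_d }{ n-1,\ t_1,\ t_2,\ \ldots,\ t_d } \prod_{k=1}^d \left((-1)^{t_k(k+1)} \binom{d}{k}^{t_k} \right) \right], \] where the sum is over all integers $t_1, \ldots, t_d \ge 0$ such that \[ \sum_{k=1}^d t_k ( p^k-1 ) = n-1. \]
   Context: Fix integers $d\ge 1$ and $p\ge 2$. For an open rectangle $R=(a_1,b_1)\times\cdots\times(a_d,b_d)\subseteq(0,1)^d$ and $1\le i\le d$, put $c_i(j)=a_i+\frac{j}{p}(b_i-a_i)$ for $0\le j\le p$. The $p$-splitting of $R$ in the coordinate $i$ is the set of $p$ open rectangles \[ H_i(R)=\{(a_1,b_1)\times\cdots\times(c_i(j-1),c_i(j))\times\cdots\times(a_d,b_d) : 1\le j\le p\}, \] where only the $i$-th factor is changed. Fix an integer $m\ge 0$, start with $S_0=\{(0,1)^d\}$, and for $k=1,\dots,m$ choose any $R\in S_{k-1}$ and any $1\le i\le d$ and set $S_k=(S_{k-1}\setminus\{R\})\cup H_i(R)$. Any resulting set $S_m$ is called a $(d,p,n)$-decomposition, where $n=1+m(p-1)=|S_m|$. $C_{d,p}(n)$ denotes the number of distinct $(d,p,n)$-decompositions (as sets of rectangles); it is $0$ if $n$ is not of the form $1+m(p-1)$ with $m\ge0$. $\binom{N}{m_0,m_1,\dots,m_d}=\frac{N!}{m_0!\,m_1!\cdots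 m_d!}$ (with $N=m_0+\cdots+m_d$) is the multinomial coefficient. *)

theory Defs
  imports Complex_Main "HOL-Library.FuncSet"
begin

text \<open>
  The open rectangle \<open>(a 1, b 1) \<times> \<dots> \<times> (a d, b d)\<close>. Points of d-dimensional space are the
  functions that are \<open>undefined\<close> outside \<open>{1..d}\<close>, so only the values of \<open>a\<close> and \<open>b\<close> on \<open>{1..d}\<close>
  matter, and they are determined by the rectangle when it is nonempty.
\<close>

definition open_rect :: "nat \<Rightarrow> (nat \<Rightarrow> real) \<Rightarrow> (nat \<Rightarrow> real) \<Rightarrow> (nat \<Rightarrow> real) set" where
  "open_rect d a b = (\<Pi>\<^sub>E i\<in>{1..d}. {a i<..<b i})"

definition cut_point ::
    "nat \<Rightarrow> (nat \<Rightarrow> real) \<Rightarrow> (nat \<Rightarrow> real) \<Rightarrow> nat \<Rightarrow> nat \<Rightarrow> real" where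
  "cut_point p a b i j = a i + real j / real p * (b i - a i)"

definition p_splitting ::
    "nat \<Rightarrow> nat \<Rightarrow> nat \<Rightarrow> (nat \<Rightarrow> real) \<Rightarrow> (nat \<Rightarrow> real) \<Rightarrow> (nat \<Rightarrow> real) set set" where
  "p_splitting d p i a b =
     (\<lambda>j. open_rect d (a(i := cut_point p a b i (j - 1))) (b(i := cut_point p a b i j))) ` {1..p}"

text \<open>\<open>splits_to d p m S\<close>: the set of rectangles \<open>S\<close> arises as an \<open>S\<^sub>m\<close>, that is, after exactly
  \<open>m\<close> splitting steps starting from the unit cube. All members of such an \<open>S\<close> are nonempty if
  \<open>p > 0\<close>, so in the rule \<open>step\<close> the splitting does not depend on the choice of \<open>a\<close> and \<open>b\<close>
  representing the rectangle.\<close>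

inductive splits_to :: "nat \<Rightarrow> nat \<Rightarrow> nat \<Rightarrow> (nat \<Rightarrow> real) set set \<Rightarrow> bool" for d p where
  start: "splits_to d p 0 {open_rect d (\<lambda>_. 0) (\<lambda>_. 1)}"
| step: "splits_to d p m S \<Longrightarrow> open_rect d a b \<in> S \<Longrightarrow> i \<in> {1..d} \<Longrightarrow>
    splits_to d p (Suc m) ((S - {open_rect d a b}) \<union> p_splitting d p i a b)"

definition is_decomposition :: "nat \<Rightarrow> nat \<Rightarrow> nat \<Rightarrow> (nat \<Rightarrow> real) set set \<Rightarrow> bool" where
  "is_decomposition d p n S \<longleftrightarrow> (\<exists>m. n = 1 + m * (p - 1) \<and> splits_to d p m S)"

definition num_decompositions :: "nat \<Rightarrow> nat \<Rightarrow> nat \<Rightarrow> nat" where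
  "num_decompositions d p n = card {S. is_decomposition d p n S}"

text \<open>A nonempty rectangle determines its endpoints and hence its splittings; every rectangle in a
  decomposition is nonempty.\<close>

lemma open_rect_nonempty_iff: "open_rect d a b \<noteq> {} \<longleftrightarrow> (\<forall>i\<in>{1..d}. a i < b i)"
  unfolding open_rect_def PiE_eq_empty_iff by (auto simp: not_less)

lemma open_rect_eqD:
  assumes "open_rect d a b = open_rect d a' b'" "open_rect d a b \<noteq> {}" "i \<in> {1..d}"
  shows "a i = a' i \<and> b i = b' i"
proof -
  have ab: "\<forall>k\<in>{1..d}. a k < b k" and ab': "\<forall>k\<in>{1..d}. a' k < b' k"
    using assms(2) unfolding assms(1) open_rect_nonempty_iff[symmetric] by assumption+
  have "\<forall>k\<in>{1..d}. {a k<..<b k} = {a' k<..<b' k}"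
  proof -
    have "{a k<..<b k} \<noteq> {}" "{a' k<..<b' k} \<noteq> {}" if "k \<in> {1..d}" for k
      using bspec[OF ab that] bspec[OF ab' that] by simp_all
    then show ?thesis
      using assms(1) unfolding open_rect_def by (subst (asm) PiE_eq_iff_not_empty) blast+
  qed
  then have "{a i<..<b i} = {a' i<..<b' i}"
    using assms(3) by blast
  moreover have "a i < b i" "a' i < b' i"
    using ab ab' assms(3) by auto
  ultimately show ?thesis
    by (metis cInf_greaterThanLessThan cSup_greaterThanLessThan)
qed

lemma open_rect_cong:
  assumes "\<And>k. k \<in> {1..d} \<Longrightarrow> a k = a' k \<and> b k = b' k"
  shows "open_rect d a b = open_rect d a' b'"
  unfolding open_rect_def using assms by (intro PiE_cong) auto

lemma p_splitting_eq:
  assumes "open_rect d a b = open_rect d a' b'" "open_rect d a b \<noteq> {}" "i \<in> {1..d}"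
  shows "p_splitting d p i a b = p_splitting d p i a' b'"
  unfolding p_splitting_def cut_point_def
  using open_rect_eqD[OF assms(1,2)] assms(3)
  by (intro image_cong refl open_rect_cong) auto

lemma splits_to_nonempty:
  assumes "splits_to d p m S" "R \<in> S"
  shows "R \<noteq> {}"
  using assms
proof (induction arbitrary: R rule: splits_to.induct)
  case start
  then show ?case
    using open_rect_nonempty_iff[of d "\<lambda>_. 0" "\<lambda>_. 1"] by simp
next
  case (step m S a b i)
  have ab: "\<forall>k\<in>{1..d}. a k < b k"
    using step.IH[OF step.hyps(2)] open_rect_nonempty_iff by blast
  show ?case
  proof (cases "R \<in> S")
    case True
    then show ?thesis using step.IH by blast
  next
    case False
    then obtain j where j: "j \<in> {1..p}" and
      R: "R = open_rect d (a(i := cut_point p a b i (j - 1))) (b(i := cut_point p a b i j))"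
      using step.prems by (auto simp: p_splitting_def)
    have "real (j - 1) / real p < real j / real p"
      using j by (intro divide_strict_right_mono) auto
    then have "cut_point p a b i (j - 1) < cut_point p a b i j"
      using ab step.hyps(3) unfolding cut_point_def
      by (intro add_strict_left_mono mult_strict_right_mono) auto
    then show ?thesis
      using ab unfolding R open_rect_nonempty_iff by auto
  qed
qed

text \<open>The set counted by \<open>num_decompositions\<close> is finite, so \<^const>\<open>card\<close> is a genuine count.\<close>

lemma splits_to_finite: "splits_to d p m S \<Longrightarrow> finite S"
  by (induction rule: splits_to.induct) (auto simp: p_splitting_def)

lemma finite_splits_to: "finite {S. splits_to d p m S}"
proof (induction m)
  case 0
  have "S = {open_rect d (\<lambda>_. 0) (\<lambda>_. 1)}" if "splits_to d p 0 S" for S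
    using that by cases simp
  then have "{S. splits_to d p 0 S} \<subseteq> {{open_rect d (\<lambda>_. 0) (\<lambda>_. 1)}}"
    by blast
  then show ?case
    by (rule finite_subset) simp
next
  case (Suc m)
  define ends where "ends R = (SOME (a, b). R = open_rect d a b)" for R
  define next_set where "next_set = (\<lambda>(S, R, i).
    (S - {R}) \<union> p_splitting d p i (fst (ends R)) (snd (ends R)))"
  have "{S. splits_to d p (Suc m) S} \<subseteq>
    next_set ` (SIGMA S:{S. splits_to d p m S}. S \<times> {1..d})"
  proof
    fix T assume "T \<in> {S. splits_to d p (Suc m) S}"
    then have "splits_to d p (Suc m) T"
      by simp
    then obtain S a b i where S: "splits_to d p m S" "open_rect d a b \<in> S" "i \<in> {1..d}"
      and T: "T = (S - {open_rect d a b}) \<union> p_splitting d p i a b"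
      by (cases rule: splits_to.cases) auto
    let ?R = "open_rect d a b"
    have "case ends ?R of (a', b') \<Rightarrow> ?R = open_rect d a' b'"
      unfolding ends_def by (rule someI[of _ "(a, b)"]) simp
    then have "?R = open_rect d (fst (ends ?R)) (snd (ends ?R))"
      by (simp add: case_prod_beta)
    then have "p_splitting d p i a b = p_splitting d p i (fst (ends ?R)) (snd (ends ?R))"
      using p_splitting_eq S(3) splits_to_nonempty[OF S(1,2)] by blast
    then have "T = next_set (S, ?R, i)"
      unfolding T next_set_def by simp
    then show "T \<in> next_set ` (SIGMA S:{S. splits_to d p m S}. S \<times> {1..d})"
      using S by blast
  qed
  moreover have "finite (SIGMA S:{S. splits_to d p m S}. S \<times> {1..d})"
    using Suc splits_to_finite by (intro finite_SigmaI) auto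
  ultimately show ?case
    using finite_surj by blast
qed

lemma finite_decompositions:
  assumes "p \<ge> 2"
  shows "finite {S. is_decomposition d p n S}"
proof (rule finite_subset)
  show "{S. is_decomposition d p n S} \<subseteq> {S. splits_to d p ((n - 1) div (p - 1)) S}"
    using assms by (auto simp: is_decomposition_def)
qed (rule finite_splits_to)

text \<open>The multinomial coefficient with lower entries \<open>m, t 1, \<dots>, t d\<close>.\<close>

definition multinomial :: "nat \<Rightarrow> nat \<Rightarrow> (nat \<Rightarrow> nat) \<Rightarrow> real" where
  "multinomial d m t = fact (m + (\<Sum>k=1..d. t k)) / (fact m * (\<Prod>k=1..d. fact (t k)))"

text \<open>The functions in \<open>exponents d p n\<close> are \<open>undefined\<close> outside \<open>{1..d}\<close>, so that each tuple
  \<open>(t 1, \<dots>, t d)\<close> is represented exactly once.\<close>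

definition exponents :: "nat \<Rightarrow> nat \<Rightarrow> nat \<Rightarrow> (nat \<Rightarrow> nat) set" where
  "exponents d p n = {t \<in> {1..d} \<rightarrow>\<^sub>E UNIV. (\<Sum>k=1..d. t k * (p ^ k - 1)) = n - 1}"

lemma finite_exponents:
  assumes "p \<ge> 2"
  shows "finite (exponents d p n)"
proof (rule finite_subset)
  show "exponents d p n \<subseteq> {1..d} \<rightarrow>\<^sub>E {..n - 1}"
  proof
    fix t assume t: "t \<in> exponents d p n"
    have "t k \<le> n - 1" if k: "k \<in> {1..d}" for k
    proof -
      have "p ^ 1 \<le> p ^ k"
        using assms k by (intro power_increasing) auto
      then have "1 \<le> p ^ k - 1"
        using assms by simp
      then have "t k * 1 \<le> t k * (p ^ k - 1)"
        by (rule mult_le_mono2)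
      also have "\<dots> \<le> (\<Sum>k=1..d. t k * (p ^ k - 1))"
        using k by (intro member_le_sum) auto
      finally show ?thesis
        using t by (simp add: exponents_def)
    qed
    then show "t \<in> {1..d} \<rightarrow>\<^sub>E {..n - 1}"
      using t by (auto simp: exponents_def PiE_iff)
  qed
qed (auto intro: finite_PiE)

end

theory Submission
  imports Defs "HOL-Computational_Algebra.Formal_Power_Series"
begin

unbundle fps_syntax

text \<open>
  Let \<open>g\<close> be the generating function of the decompositions. If a decomposition refines the
  \<open>p\<close>-splitting of the cube in every coordinate of a set \<open>J\<close>, then it restricts to an arbitrary
  decomposition of each of the \<open>p ^ card J\<close> cells of the corresponding grid, so these are counted by
  \<open>g ^ (p ^ card J)\<close>. Every decomposition other than the cube itself refines such a splitting in at
  least one coordinate, so that inclusion-exclusion over \<open>J\<close> gives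
  \<open>(\<Sum>k\<le>d. (-1) ^ k * (d choose k) * g ^ (p ^ k)) = X\<close>. The formula follows by Lagrange inversion and
  expansion of the resulting negative power.
\<close>

subsection \<open>Decompositions as sets of digit words\<close>

text \<open>A box reached from the unit cube by splittings is encoded by one word of base-\<open>p\<close> digits for
  each coordinate, the outermost cut first; \<open>decs\<close> contains the encoded decompositions, built
  from the outermost splitting inwards.\<close>

definition push :: "nat \<Rightarrow> nat \<Rightarrow> (nat \<Rightarrow> nat list) \<Rightarrow> nat \<Rightarrow> nat list" where
  "push i j c = c(i := j # c i)"

text \<open>A step of \<open>splits_to\<close> cuts one of the current boxes, so its digit goes to
  the end of a word, whereas \<open>push\<close> adds an outermost digit at the front.\<close>

definition split_cell :: "nat \<Rightarrow> nat \<Rightarrow> (nat \<Rightarrow> nat list) \<Rightarrow> (nat \<Rightarrow> nat list) set" where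
  "split_cell p i c = (\<lambda>j. c(i := c i @ [j])) ` {..<p}"

text \<open>Words outside \<open>{1..d}\<close> are forced to be empty because a rectangle carries
  no information there; this makes the encoding injective.\<close>

definition cells :: "nat \<Rightarrow> nat \<Rightarrow> (nat \<Rightarrow> nat list) set" where
  "cells d p = {c. \<forall>i. set (c i) \<subseteq> {..<p} \<and> (i \<notin> {1..d} \<longrightarrow> c i = [])}"

inductive_set decs :: "nat \<Rightarrow> nat \<Rightarrow> (nat \<Rightarrow> nat list) set set" for d p where
  root: "{\<lambda>_. []} \<in> decs d p"
| split: "i \<in> {1..d} \<Longrightarrow> (\<And>j. j < p \<Longrightarrow> F j \<in> decs d p) \<Longrightarrow> (\<Union>j<p. push i j ` F j) \<in> decs d p"

lemma push_eq_iff: "push i j c = push i j' c' \<longleftrightarrow> j = j' \<and> c = c'"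
  by (auto simp: push_def fun_eq_iff split: if_splits)

lemma inj_push: "inj_on (push i j) A"
  by (rule inj_onI) (simp add: push_eq_iff)

lemma push_commute: "i \<noteq> i' \<Longrightarrow> push i j (push i' j' c) = push i' j' (push i j c)"
  by (simp add: push_def fun_upd_twist)

lemma vimage_push_union: "j < p \<Longrightarrow> push i j -` (\<Union>j<p. push i j ` F j) = F j"
  by (auto simp: push_eq_iff)

lemma card_union_push:
  assumes "\<And>j. j < p \<Longrightarrow> finite (F j)"
  shows "card (\<Union>j<p. push i j ` F j) = (\<Sum>j<p. card (F j))"
proof -
  have "card (\<Union>j<p. push i j ` F j) = (\<Sum>j<p. card (push i j ` F j))"
    using assms by (intro card_UN_disjoint) (auto simp: push_eq_iff)
  then show ?thesis
    by (simp add: card_image inj_push)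
qed

lemma decs_finite: "T \<in> decs d p \<Longrightarrow> finite T"
  by (induction rule: decs.induct) auto

lemma decs_nonempty: "T \<in> decs d p \<Longrightarrow> 0 < p \<Longrightarrow> T \<noteq> {}"
  by (induction rule: decs.induct) auto

lemma root_in_cells: "(\<lambda>_. []) \<in> cells d p"
  by (simp add: cells_def)

lemma decs_subset_cells: "T \<in> decs d p \<Longrightarrow> T \<subseteq> cells d p"
  by (induction rule: decs.induct) (fastforce simp: cells_def push_def)+

lemma split_cell_push: "split_cell p i (push i' j c) = push i' j ` split_cell p i c"
  unfolding split_cell_def image_image
  by (rule image_cong) (auto simp: push_def fun_eq_iff)

text \<open>Bridges the two directions of construction: a cut of a cell inside slab \<open>j\<close>
  of the outermost splitting is a cut of the decomposition of that slab, so induction applies there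
  and the other slabs stay fixed. The cardinality claim shows that the new cells are distinct and
  not yet in \<open>T\<close>.\<close>

lemma decs_step:
  assumes "T \<in> decs d p" "c \<in> T" "i \<in> {1..d}"
  shows "T - {c} \<union> split_cell p i c \<in> decs d p \<and>
    card (T - {c} \<union> split_cell p i c) + 1 = card T + p"
  using assms(1,2)
proof (induction arbitrary: c rule: decs.induct)
  case root
  then have "{\<lambda>_. []} - {c} \<union> split_cell p i c = (\<Union>j<p. push i j ` {\<lambda>_. []})"
    by (auto simp: split_cell_def push_def fun_upd_def)
  then show ?case
    using decs.split[OF assms(3), of p "\<lambda>_. {\<lambda>_. []}"] card_union_push[of p "\<lambda>_. {\<lambda>_. []}" i]
    by (simp add: decs.root del: UN_simps)
next
  case (split i' F)
  then obtain j c' where j: "j < p" "c' \<in> F j" "c = push i' j c'"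
    by auto
  define G where "G = F(j := F j - {c'} \<union> split_cell p i c')"
  have G: "G k \<in> decs d p" if "k < p" for k
    using split.hyps(2) split.IH[OF that] that j by (auto simp: G_def)
  have eq: "(\<Union>j<p. push i' j ` F j) - {c} \<union> split_cell p i c = (\<Union>j<p. push i' j ` G j)"
    (is "?L = ?R")
  proof (rule set_eqI)
    fix x
    show "x \<in> ?L \<longleftrightarrow> x \<in> ?R"
      unfolding j(3) split_cell_push using j(1,2)
      by (auto simp: G_def push_eq_iff split: if_splits)
  qed
  have "(\<Sum>k<p. card (G k)) + 1 = (\<Sum>k<p. card (F k)) + p"
  proof -
    have "card (G j) + 1 = card (F j) + p"
      using split.IH[OF j(1,2)] by (simp add: G_def)
    moreover have "(\<Sum>k\<in>{..<p} - {j}. card (G k)) = (\<Sum>k\<in>{..<p} - {j}. card (F k))"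
      by (rule sum.cong) (auto simp: G_def)
    ultimately show ?thesis
      using j(1) by (simp add: sum.remove[of "{..<p}" j])
  qed
  then have "card ?R + 1 = card (\<Union>j<p. push i' j ` F j) + p"
    using card_union_push[of p F i'] card_union_push[of p G i'] decs_finite[OF G]
      decs_finite[OF split.hyps(2)] by simp
  then show ?case
    unfolding eq using decs.split[OF split.hyps(1), of p G] G by blast
qed

text \<open>The key to the inclusion-exclusion: a decomposition that respects the cuts of the cube in
  coordinate \<open>i\<close> may have started with a cut in another coordinate, but it can always be
  reordered to start with coordinate \<open>i\<close>.\<close>

lemma decs_slab:
  assumes "T \<in> decs d p" "\<And>c. c \<in> T \<Longrightarrow> c i \<noteq> []" "j < p"
  shows "push i j -` T \<in> decs d p"
  using assms(1,2)
proof (induction rule: decs.induct)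
  case root
  then show ?case by simp
next
  case (split i' F)
  show ?case
  proof (cases "i' = i")
    case True
    then show ?thesis
      using split.hyps(2)[OF assms(3)] by (simp only: vimage_push_union[OF assms(3)])
  next
    case False
    have "push i j -` F j' \<in> decs d p" if "j' < p" for j'
    proof (rule split.IH[OF that])
      fix c assume "c \<in> F j'"
      then have "push i' j' c i \<noteq> []"
        using split.prems that by blast
      then show "c i \<noteq> []"
        using False by (simp add: push_def)
    qed
    \<comment> \<open>This exchanges the two outermost cuts: slab \<open>j\<close> in direction
      \<open>i\<close> is itself cut first in direction \<open>i'\<close>, and its pieces are the
      slabs of the \<open>F j'\<close>.\<close>
    moreover have "push i j -` (\<Union>j'<p. push i' j' ` F j') =
        (\<Union>j'<p. push i' j' ` (push i j -` F j'))"
    proof (intro equalityI subsetI)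
      fix c assume "c \<in> push i j -` (\<Union>j'<p. push i' j' ` F j')"
      then obtain j' c' where c': "j' < p" "c' \<in> F j'" "push i j c = push i' j' c'"
        by auto
      \<comment> \<open>Since \<open>i\<close> and \<open>i'\<close> differ, \<open>c\<close> and
        \<open>c'\<close> share the core \<open>c(i' := tl (c i'))\<close>: \<open>c\<close> has the
        extra digit \<open>j'\<close> in coordinate \<open>i'\<close>, and \<open>c'\<close> has the
        extra digit \<open>j\<close> in coordinate \<open>i\<close>.\<close>
      from c'(3) False have "c = push i' j' (c(i' := tl (c i')))"
        "c' = push i j (c(i' := tl (c i')))"
        unfolding push_def fun_eq_iff by (metis fun_upd_apply list.sel(3))+
      with c' show "c \<in> (\<Union>j'<p. push i' j' ` (push i j -` F j'))"
        by auto
    next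
      fix c assume "c \<in> (\<Union>j'<p. push i' j' ` (push i j -` F j'))"
      then obtain j' c' where "j' < p" "push i j c' \<in> F j'" "c = push i' j' c'"
        by auto
      then show "c \<in> push i j -` (\<Union>j'<p. push i' j' ` F j')"
        using False by (auto simp: push_commute[of i i'] push_eq_iff)
    qed
    ultimately show ?thesis
      using split.hyps(1) by (simp add: decs.split del: UN_simps vimage_UN)
  qed
qed

subsection \<open>Decompositions into rectangles\<close>

text \<open>The base-\<open>p\<close> fraction with these digits after the point: the left endpoint
  of the subinterval of the unit interval addressed by the word.\<close>

fun word_val :: "nat \<Rightarrow> nat list \<Rightarrow> real" where
  "word_val p [] = 0"
| "word_val p (j # w) = (real j + word_val p w) / real p"

definition rect :: "nat \<Rightarrow> nat \<Rightarrow> (nat \<Rightarrow> nat list) \<Rightarrow> (nat \<Rightarrow> real) set" where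
  "rect d p c = open_rect d (\<lambda>i. word_val p (c i))
     (\<lambda>i. word_val p (c i) + 1 / real p ^ length (c i))"

lemma word_val_snoc:
  "word_val p (w @ [j]) = word_val p w + real j / real p ^ Suc (length w)"
  by (induction w) (simp_all add: field_simps add_divide_distrib)

lemma word_val_bounds:
  assumes "set w \<subseteq> {..<p}"
  shows "0 \<le> word_val p w \<and> word_val p w < 1"
  using assms
proof (induction w)
  case (Cons j w)
  then have "real j + 1 \<le> real p"
    by simp
  moreover have "0 \<le> word_val p w" "word_val p w < 1"
    using Cons by simp_all
  ultimately show ?case
    by (simp add: divide_less_eq)
qed simp

text \<open>Fractional tails lie below 1, so the leading digit is an integer part and the digits can
  be peeled off. Equal lengths matter because trailing zeros do not change the value.\<close>

lemma word_val_inj: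
  assumes "set v \<subseteq> {..<p}" "set w \<subseteq> {..<p}" "length v = length w" "word_val p v = word_val p w"
  shows "v = w"
  using assms(3,1,2,4)
proof (induction v w rule: list_induct2)
  case (Cons j v k w)
  then have eq: "real j + word_val p v = real k + word_val p w"
    by auto
  moreover have "0 \<le> word_val p v" "word_val p v < 1" "0 \<le> word_val p w" "word_val p w < 1"
    using word_val_bounds[of v p] word_val_bounds[of w p] Cons.prems by auto
  ultimately have jk: "j = k"
    by linarith
  with eq have "word_val p v = word_val p w"
    by simp
  then show ?case
    using Cons jk by simp
qed simp

lemma rect_nonempty: "0 < p \<Longrightarrow> rect d p c \<noteq> {}"
  unfolding rect_def open_rect_nonempty_iff by simp

lemma rect_root: "rect d p (\<lambda>_. []) = open_rect d (\<lambda>_. 0) (\<lambda>_. 1)"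
  by (simp add: rect_def)

text \<open>The side lengths are powers of \<open>1 / p\<close> and give the word lengths; the left
  endpoints then give the digits.\<close>

lemma inj_on_rect:
  assumes "2 \<le> p"
  shows "inj_on (rect d p) (cells d p)"
proof (rule inj_onI)
  fix c c' assume c: "c \<in> cells d p" "c' \<in> cells d p" and eq: "rect d p c = rect d p c'"
  have "c i = c' i" for i
  proof (cases "i \<in> {1..d}")
    case True
    have *: "word_val p (c i) = word_val p (c' i) \<and>
      word_val p (c i) + 1 / real p ^ length (c i) = word_val p (c' i) + 1 / real p ^ length (c' i)"
      by (rule open_rect_eqD[OF eq[unfolded rect_def] _ True])
        (use rect_nonempty[of p d c] assms in \<open>simp add: rect_def\<close>)
    then have "1 / real p ^ length (c i) = 1 / real p ^ length (c' i)"
      by linarith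
    then have "length (c i) = length (c' i)"
      using assms by simp
    then show ?thesis
      using * c by (intro word_val_inj[of _ p]) (auto simp: cells_def)
  qed (use c in \<open>simp add: cells_def\<close>)
  then show "c = c'" ..
qed

lemma p_splitting_rect:
  assumes "0 < p"
  shows "p_splitting d p i (\<lambda>i. word_val p (c i))
    (\<lambda>i. word_val p (c i) + 1 / real p ^ length (c i)) = rect d p ` split_cell p i c"
proof -
  \<comment> \<open>Pieces are numbered from 1 but digits from 0, hence
    \<open>j - 1\<close>.\<close>
  have "p_splitting d p i (\<lambda>i. word_val p (c i))
    (\<lambda>i. word_val p (c i) + 1 / real p ^ length (c i)) =
    (\<lambda>j. rect d p (c(i := c i @ [j - 1]))) ` {1..p}"
    unfolding p_splitting_def
  proof (rule image_cong)
    fix j assume "j \<in> {1..p}"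
    then have "1 \<le> j" by simp
    then show "open_rect d ((\<lambda>i. word_val p (c i))(i := cut_point p (\<lambda>i. word_val p (c i))
        (\<lambda>i. word_val p (c i) + 1 / real p ^ length (c i)) i (j - 1)))
        ((\<lambda>i. word_val p (c i) + 1 / real p ^ length (c i))(i := cut_point p (\<lambda>i. word_val p (c i))
        (\<lambda>i. word_val p (c i) + 1 / real p ^ length (c i)) i j)) =
      rect d p (c(i := c i @ [j - 1]))"
      unfolding rect_def using assms
      by (intro open_rect_cong)
        (auto simp: cut_point_def word_val_snoc of_nat_diff field_simps)
  qed simp
  also have "\<dots> = (\<lambda>j. rect d p (c(i := c i @ [j]))) ` (\<lambda>j. j - 1) ` {1..p}"
    by (simp add: image_image)
  also have "(\<lambda>j. j - 1) ` {1..p} = {..<p}"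
    by (auto simp: image_iff intro!: bexI[of _ "Suc _"])
  finally show ?thesis
    by (simp add: split_cell_def image_image fun_upd_def)
qed

text \<open>Every splitting of a rectangle is mirrored by \<open>decs_step\<close> on words.
  Carrying the cardinality along ties the number of steps to the number of cells.\<close>

lemma splits_to_imp_decs:
  assumes "splits_to d p m S" "2 \<le> p"
  shows "\<exists>T\<in>decs d p. card T = 1 + m * (p - 1) \<and> S = rect d p ` T"
  using assms(1)
proof (induction rule: splits_to.induct)
  case start
  show ?case
    by (rule bexI[OF _ decs.root]) (simp add: rect_root)
next
  case (step m S a b i)
  then obtain T where T: "T \<in> decs d p" "card T = 1 + m * (p - 1)" "S = rect d p ` T"
    by auto
  with step.hyps obtain c where c: "c \<in> T" "open_rect d a b = rect d p c"
    by auto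
  \<comment> \<open>The given \<open>a\<close> and \<open>b\<close> need only agree with the
    endpoints encoded by \<open>c\<close> on \<open>{1..d}\<close>, so independence of the
    representation is used.\<close>
  have split: "p_splitting d p i a b = rect d p ` split_cell p i c"
    using p_splitting_eq[OF c(2)[unfolded rect_def] _ step.hyps(3)] rect_nonempty[of p d c]
      p_splitting_rect[of p d i c] assms(2) c(2) by simp
  have "rect d p ` T - {rect d p c} = rect d p ` (T - {c})"
    using inj_on_image_set_diff[OF inj_on_rect[OF assms(2)], where A = T and B = "{c}"] c(1)
      decs_subset_cells[OF T(1)] by auto
  then have "S - {open_rect d a b} \<union> p_splitting d p i a b =
      rect d p ` (T - {c} \<union> split_cell p i c)"
    unfolding split unfolding T(3) c(2) by (simp add: image_Un)
  moreover have "card (T - {c} \<union> split_cell p i c) = 1 + Suc m * (p - 1)"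
    using decs_step[OF T(1) c(1) step.hyps(3)] T(2) assms(2) by (cases p) auto
  ultimately show ?case
    using decs_step[OF T(1) c(1) step.hyps(3)] by blast
qed

section \<open>Realizing encoded decompositions by successive splittings\<close>

definition prepend :: "(nat \<Rightarrow> nat list) \<Rightarrow> (nat \<Rightarrow> nat list) \<Rightarrow> nat \<Rightarrow> nat list" where
  "prepend c u = (\<lambda>i. c i @ u i)"

lemma prepend_inject: "prepend c u = prepend c v \<longleftrightarrow> u = v"
  by (auto simp: prepend_def fun_eq_iff)

lemma prepend_root: "prepend c (\<lambda>_. []) = c" "prepend (\<lambda>_. []) c = c"
  by (simp_all add: prepend_def)

lemma prepend_push: "prepend c (push i j u) = prepend (c(i := c i @ [j])) u"
  by (auto simp: prepend_def push_def fun_eq_iff)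

lemma prepend_in_cells: "c \<in> cells d p \<Longrightarrow> u \<in> cells d p \<Longrightarrow> prepend c u \<in> cells d p"
  by (simp add: cells_def prepend_def)

lemma splits_to_step:
  assumes "splits_to d p m (rect d p ` A)" "A \<subseteq> cells d p" "c \<in> A" "i \<in> {1..d}" "2 \<le> p"
  shows "splits_to d p (Suc m) (rect d p ` (A - {c} \<union> split_cell p i c))"
proof -
  define a where "a = (\<lambda>i. word_val p (c i))"
  define b where "b = (\<lambda>i. word_val p (c i) + 1 / real p ^ length (c i))"
  have c: "open_rect d a b = rect d p c"
    by (simp add: rect_def a_def b_def)
  have split: "p_splitting d p i a b = rect d p ` split_cell p i c"
    unfolding a_def b_def using assms(5) by (intro p_splitting_rect) simp
  have "open_rect d a b \<in> rect d p ` A"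
    unfolding c using assms(3) by blast
  then have "splits_to d p (Suc m) (rect d p ` A - {open_rect d a b} \<union> p_splitting d p i a b)"
    by (rule splits_to.step[OF assms(1) _ assms(4)])
  moreover have "rect d p ` A - {rect d p c} = rect d p ` (A - {c})"
    using inj_on_image_set_diff[OF inj_on_rect[OF assms(5)], where A = A and B = "{c}"] assms(2,3)
    by auto
  ultimately show ?thesis
    by (simp only: c split image_Un)
qed

text \<open>Steps are sequential while \<open>decs\<close> refines all slabs at once, so the claim
  is generalized to refining one cell \<open>c\<close> by the pattern \<open>U\<close> beside
  arbitrary other cells \<open>A\<close>. Keeping \<open>A\<close> free of subcells of
  \<open>c\<close> ensures that later removals never affect \<open>A\<close>.\<close>

lemma splits_to_graft:
  assumes "U \<in> decs d p" "2 \<le> p" "c \<in> cells d p" "A \<subseteq> cells d p" "\<And>u. prepend c u \<notin> A"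
    and "\<exists>m. splits_to d p m (rect d p ` (insert c A))"
  shows "\<exists>m. splits_to d p m (rect d p ` (A \<union> prepend c ` U))"
  using assms(1,3-)
proof (induction arbitrary: c A rule: decs.induct)
  case root
  then show ?case
    by (simp add: prepend_root)
next
  case (split i F)
  define cj where "cj j = c(i := c i @ [j])" for j
  have cj: "prepend (cj j) u = prepend c (push i j u)" for j u
    by (simp add: cj_def prepend_push)
  have cj_cells: "cj j \<in> cells d p" if "j < p" for j
    using split.prems(1) split.hyps(1) that by (auto simp: cells_def cj_def)
  \<comment> \<open>Invariant: \<open>c\<close> has been cut in coordinate \<open>i\<close>, the
    first \<open>q\<close> pieces are fully refined, and the remaining ones are still
    undivided.\<close>
  have "\<exists>m. splits_to d p m (rect d p ` (A \<union> (\<Union>j<q. prepend (cj j) ` F j) \<union> cj ` {q..<p}))"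
    if "q \<le> p" for q
    using that
  proof (induction q)
    case 0
    obtain m where "splits_to d p m (rect d p ` insert c A)"
      using split.prems(4) by blast
    then have "splits_to d p (Suc m) (rect d p ` (insert c A - {c} \<union> split_cell p i c))"
      using split.prems(1,2) split.hyps(1) assms(2) by (intro splits_to_step) auto
    moreover have "insert c A - {c} = A"
      using split.prems(3)[of "\<lambda>_. []"] by (simp add: prepend_root)
    moreover have "split_cell p i c = cj ` {0..<p}"
      by (simp add: split_cell_def cj_def lessThan_atLeast0)
    ultimately show ?case
      by auto
  next
    case (Suc q)
    \<comment> \<open>Everything except piece \<open>q\<close>, as the new context for refining that
      piece.\<close>
    define A' where "A' = A \<union> (\<Union>j<q. prepend (cj j) ` F j) \<union> cj ` {Suc q..<p}"
    have "{q..<p} = insert q {Suc q..<p}"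
      using Suc.prems by auto
    then have "insert (cj q) A' = A \<union> (\<Union>j<q. prepend (cj j) ` F j) \<union> cj ` {q..<p}"
      by (simp add: A'_def)
    then have "\<exists>m. splits_to d p m (rect d p ` insert (cj q) A')"
      using Suc by simp
    moreover have "A' \<subseteq> cells d p"
    proof -
      have "prepend (cj j) u \<in> cells d p" if "j < q" "u \<in> F j" for j u
        using that Suc.prems cj_cells decs_subset_cells[OF split.hyps(2)[of j]]
        by (intro prepend_in_cells) auto
      then show ?thesis
        using split.prems(2) cj_cells by (auto simp: A'_def)
    qed
    moreover have "prepend (cj q) u \<notin> A'" for u
    proof -
      have notin: "prepend (cj q) u \<notin> A"
        unfolding cj by (rule split.prems(3))
      have neq: "prepend (cj q) u \<noteq> prepend (cj j) v" if "j \<noteq> q" for j v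
        using that by (simp add: cj prepend_inject push_eq_iff)
      have neq': "prepend (cj q) u \<noteq> cj j" if "j \<noteq> q" for j
        using neq[OF that, of "\<lambda>_. []"] by (simp add: prepend_root)
      show ?thesis
      proof
        assume "prepend (cj q) u \<in> A'"
        then consider "prepend (cj q) u \<in> A"
          | j v where "j < q" "prepend (cj q) u = prepend (cj j) v"
          | j where "Suc q \<le> j" "prepend (cj q) u = cj j"
          unfolding A'_def by (elim UnE UN_E imageE) auto
        then show False
        proof cases
          case (2 j v)
          then show ?thesis using neq[of j v] by simp
        next
          case (3 j)
          then show ?thesis using neq'[of j] by simp
        qed (use notin in blast)
      qed
    qed
    ultimately have "\<exists>m. splits_to d p m (rect d p ` (A' \<union> prepend (cj q) ` F q))"
      using split.IH[of q "cj q" A'] cj_cells[of q] Suc.prems by simp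
    moreover have "A' \<union> prepend (cj q) ` F q =
        A \<union> (\<Union>j<Suc q. prepend (cj j) ` F j) \<union> cj ` {Suc q..<p}"
      unfolding A'_def lessThan_Suc by blast
    ultimately show ?case
      by simp
  qed
  from this[of p] show ?case
    by (simp add: cj image_UN image_image)
qed

lemma decs_imp_splits_to:
  assumes "T \<in> decs d p" "2 \<le> p"
  shows "\<exists>m. splits_to d p m (rect d p ` T)"
proof -
  have "splits_to d p 0 (rect d p ` {\<lambda>_. []})"
    using splits_to.start by (simp add: rect_root)
  then show ?thesis
    using splits_to_graft[OF assms root_in_cells, of "{}"] by (auto simp: prepend_root)
qed

lemma inj_on_image_rect: "2 \<le> p \<Longrightarrow> inj_on ((`) (rect d p)) (decs d p)"
  by (rule inj_on_subset[OF inj_on_image_Pow[OF inj_on_rect]]) (auto dest: decs_subset_cells)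

lemma decomposition_eq_decs:
  assumes "2 \<le> p"
  shows "{S. is_decomposition d p n S} = (`) (rect d p) ` {T \<in> decs d p. card T = n}"
proof (intro equalityI subsetI)
  fix S assume "S \<in> {S. is_decomposition d p n S}"
  then show "S \<in> (`) (rect d p) ` {T \<in> decs d p. card T = n}"
    using splits_to_imp_decs[OF _ assms] by (fastforce simp: is_decomposition_def)
next
  fix S assume "S \<in> (`) (rect d p) ` {T \<in> decs d p. card T = n}"
  then obtain T where T: "T \<in> decs d p" "card T = n" "S = rect d p ` T"
    by auto
  obtain m where m: "splits_to d p m S"
    using decs_imp_splits_to[OF T(1) assms] T(3) by auto
  \<comment> \<open>The number \<open>m\<close> of steps obtained by grafting is unspecified.
    Translating \<open>S\<close> back yields an encoding with \<open>1 + m * (p - 1)\<close> cells,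
    which injectivity identifies with \<open>T\<close>.\<close>
  obtain T' where T': "T' \<in> decs d p" "card T' = 1 + m * (p - 1)" "S = rect d p ` T'"
    using splits_to_imp_decs[OF m assms] by auto
  have "T' = T"
    using T T' by (intro inj_onD[OF inj_on_image_rect[OF assms]]) auto
  then show "S \<in> {S. is_decomposition d p n S}"
    using m T T' by (auto simp: is_decomposition_def)
qed

lemma num_decompositions_eq:
  assumes "2 \<le> p"
  shows "num_decompositions d p n = card {T \<in> decs d p. card T = n}"
  unfolding num_decompositions_def decomposition_eq_decs[OF assms]
  by (rule card_image[OF inj_on_subset[OF inj_on_image_rect[OF assms]]]) simp

lemma finite_decs:
  assumes "2 \<le> p"
  shows "finite {T \<in> decs d p. card T = n}"
  using finite_decompositions[OF assms, of d n] unfolding decomposition_eq_decs[OF assms]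
  by (rule finite_imageD[OF _ inj_on_subset[OF inj_on_image_rect[OF assms]]]) simp

subsection \<open>The functional equation of the generating function\<close>

text \<open>Splitting off the head of a list turns the count into a Cauchy product. Finiteness is
  proved simultaneously because counting the disjoint union needs it.\<close>

lemma card_lists_of_weight:
  fixes s :: "'a \<Rightarrow> nat"
  assumes fin: "\<And>n. finite {x \<in> C. s x = n}"
  shows "finite {xs. length xs = q \<and> set xs \<subseteq> C \<and> sum_list (map s xs) = n} \<and>
    real (card {xs. length xs = q \<and> set xs \<subseteq> C \<and> sum_list (map s xs) = n}) =
    (Abs_fps (\<lambda>n. real (card {x \<in> C. s x = n})) ^ q) $ n"
proof (induction q arbitrary: n)
  case 0
  have "{xs. length xs = 0 \<and> set xs \<subseteq> C \<and> sum_list (map s xs) = n} = (if n = 0 then {[]} else {})"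
    by auto
  then show ?case by simp
next
  case (Suc q)
  let ?L = "\<lambda>q n. {xs. length xs = q \<and> set xs \<subseteq> C \<and> sum_list (map s xs) = n}"
  define B where "B i = (\<lambda>(x, xs). x # xs) ` ({x \<in> C. s x = i} \<times> ?L q (n - i))" for i
  have eq: "?L (Suc q) n = (\<Union>i\<in>{0..n}. B i)"
  proof (intro equalityI subsetI)
    fix xs assume "xs \<in> ?L (Suc q) n"
    then obtain y ys where "xs = y # ys" "y \<in> C" "set ys \<subseteq> C" "length ys = q"
      "s y + sum_list (map s ys) = n"
      by (cases xs) auto
    then show "xs \<in> (\<Union>i\<in>{0..n}. B i)"
      by (auto simp: B_def image_iff intro!: bexI[of _ "s y"])
  qed (auto simp: B_def)
  have finB: "finite (B i)" for i
    unfolding B_def using fin Suc by blast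
  have cardB: "real (card (B i)) = real (card {x \<in> C. s x = i}) *
      (Abs_fps (\<lambda>n. real (card {x \<in> C. s x = n})) ^ q) $ (n - i)" for i
  proof -
    have "card (B i) = card ({x \<in> C. s x = i} \<times> ?L q (n - i))"
      unfolding B_def by (rule card_image) (auto simp: inj_on_def)
    then show ?thesis
      using Suc[of "n - i"] by (simp add: card_cartesian_product)
  qed
  have "card (?L (Suc q) n) = (\<Sum>i\<in>{0..n}. card (B i))"
    unfolding eq using finB by (intro card_UN_disjoint) (auto simp: B_def)
  then have "real (card (?L (Suc q) n)) = (Abs_fps (\<lambda>n. real (card {x \<in> C. s x = n})) ^ Suc q) $ n"
    by (simp add: cardB fps_mult_nth)
  moreover have "finite (?L (Suc q) n)"
    unfolding eq using finB by blast
  ultimately show ?case by blast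
qed

text \<open>The decompositions that refine the splitting of the unit cube in each of the coordinates in \<open>J\<close>.\<close>

definition decs_through :: "nat \<Rightarrow> nat \<Rightarrow> nat set \<Rightarrow> (nat \<Rightarrow> nat list) set set" where
  "decs_through d p J = {T \<in> decs d p. \<forall>i\<in>J. \<forall>c\<in>T. c i \<noteq> []}"

text \<open>A decomposition respecting the cuts in coordinate \<open>i\<close> is the same as an
  independent choice of \<open>p\<close> slabs, by \<open>decs_slab\<close>. As \<open>i\<close> is
  not in \<open>J\<close>, the conditions for \<open>J\<close> pass to and from the slabs; lists of
  slabs match the coefficient count for a \<open>p\<close>-th power.\<close>

lemma decs_through_bij:
  assumes "i \<in> {1..d}" "i \<notin> J" "2 \<le> p"
  shows "bij_betw (\<lambda>xs. \<Union>j<p. push i j ` (xs ! j))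
    {xs. length xs = p \<and> set xs \<subseteq> decs_through d p J \<and> sum_list (map card xs) = n}
    {T \<in> decs_through d p (insert i J). card T = n}"
proof -
  define g where "g T = map (\<lambda>j. push i j -` T) [0..<p]" for T
  let ?f = "\<lambda>xs. \<Union>j<p. push i j ` (xs ! j)"
  let ?A = "{xs. length xs = p \<and> set xs \<subseteq> decs_through d p J \<and> sum_list (map card xs) = n}"
  let ?B = "{T \<in> decs_through d p (insert i J). card T = n}"
  have card_f: "card (?f xs) = sum_list (map card xs)"
    if "length xs = p" "\<And>j. j < p \<Longrightarrow> xs ! j \<in> decs d p" for xs
    using card_union_push[of p "\<lambda>j. xs ! j" i] decs_finite[OF that(2)] that(1)
    by (simp add: sum_list_sum_nth atLeast0LessThan)
  have 1: "?f xs \<in> ?B \<and> g (?f xs) = xs" if xs: "xs \<in> ?A" for xs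
  proof -
    have "xs ! j \<in> decs_through d p J" if "j < p" for j
      using xs that nth_mem by blast
    then have x: "xs ! j \<in> decs d p" "\<And>k c. k \<in> J \<Longrightarrow> c \<in> xs ! j \<Longrightarrow> c k \<noteq> []" if "j < p" for j
      using that by (auto simp: decs_through_def)
    have "?f xs \<in> decs d p"
      by (rule decs.split[OF assms(1) x(1)])
    moreover have "c k \<noteq> []" if "k \<in> insert i J" "c \<in> ?f xs" for c k
      using that x(2) assms(2) by (fastforce simp: push_def split: if_splits)
    moreover have "g (?f xs) = xs"
      using xs unfolding g_def
      by (intro nth_equalityI) (simp_all add: vimage_push_union del: vimage_UN UN_simps)
    ultimately show ?thesis
      using card_f[of xs] x(1) xs by (simp add: decs_through_def)
  qed
  have 2: "g T \<in> ?A \<and> ?f (g T) = T" if T: "T \<in> ?B" for T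
  proof -
    have T': "T \<in> decs d p" "\<And>k c. k \<in> insert i J \<Longrightarrow> c \<in> T \<Longrightarrow> c k \<noteq> []"
      using T by (auto simp: decs_through_def)
    have gT: "g T ! j \<in> decs d p" if "j < p" for j
      using decs_slab[OF T'(1) _ that, of i] T'(2) that by (simp add: g_def)
    have eq: "?f (g T) = T"
    proof (intro equalityI subsetI)
      fix c assume c: "c \<in> T"
      then obtain j w where jw: "c i = j # w"
        using T'(2)[of i c] by (cases "c i") auto
      moreover have "set (c i) \<subseteq> {..<p}"
        using decs_subset_cells[OF T'(1)] c by (auto simp: cells_def)
      ultimately have "j < p"
        by simp
      moreover have "c = push i j (c(i := w))"
        using jw by (auto simp: push_def fun_eq_iff)
      ultimately show "c \<in> ?f (g T)"
        using c by (auto simp: g_def image_iff)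
    qed (auto simp: g_def)
    have "c k \<noteq> []" if "k \<in> J" "push i j c \<in> T" for j k c
      using T'(2)[OF _ that(2), of k] that(1) assms(2) by (auto simp: push_def split: if_splits)
    then have "set (g T) \<subseteq> decs_through d p J"
      using gT by (fastforce simp: decs_through_def g_def)
    then show ?thesis
      using eq card_f[OF _ gT] T by (simp add: g_def)
  qed
  show ?thesis
    by (rule bij_betw_byWitness[of _ g]) (use 1 2 in blast)+
qed

definition decs_gf :: "nat \<Rightarrow> nat \<Rightarrow> nat set \<Rightarrow> real fps" where
  "decs_gf d p J = Abs_fps (\<lambda>n. real (card {T \<in> decs_through d p J. card T = n}))"

lemma finite_decs_through: "2 \<le> p \<Longrightarrow> finite {T \<in> decs_through d p J. card T = n}"
  by (rule finite_subset[OF _ finite_decs[of p d n]]) (auto simp: decs_through_def)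

lemma decs_gf_insert:
  assumes "i \<in> {1..d}" "i \<notin> J" "2 \<le> p"
  shows "decs_gf d p (insert i J) = decs_gf d p J ^ p"
proof (rule fps_ext)
  fix n
  show "decs_gf d p (insert i J) $ n = (decs_gf d p J ^ p) $ n"
    unfolding decs_gf_def fps_nth_Abs_fps bij_betw_same_card[OF decs_through_bij[OF assms], symmetric]
    using card_lists_of_weight[OF finite_decs_through[OF assms(3)]] by blast
qed

lemma decs_gf_eq_power:
  assumes "J \<subseteq> {1..d}" "2 \<le> p"
  shows "decs_gf d p J = decs_gf d p {} ^ (p ^ card J)"
proof -
  have "finite J"
    using assms(1) finite_subset by blast
  then show ?thesis
    using assms(1)
    by (induction J) (simp_all add: decs_gf_insert[OF _ _ assms(2)] mult.commute flip: power_mult)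
qed

text \<open>This is the product \<open>(1 - 1) ^ card I\<close> multiplied out.\<close>

lemma alternating_sum_Pow:
  assumes "finite I"
  shows "(\<Sum>J\<in>Pow I. (-1) ^ card J :: real) = (if I = {} then 1 else 0)"
  using prod_diff_conv_sum[OF assms, of "\<lambda>_. 1 :: real" "\<lambda>_. 1"] assms
  by (cases "I = {}") (simp_all add: power_0_left)

text \<open>The coordinate of an outermost cut has a nonempty word in every cell, so only the
  undivided cube lacks such a coordinate.\<close>

lemma decs_avoid_all_slabs:
  assumes "T \<in> decs d p" 
  shows "{i \<in> {1..d}. \<forall>c\<in>T. c i \<noteq> []} = {} \<longleftrightarrow> T = {\<lambda>_. []}"
  using assms
proof cases
  case (split i F)
  then have "i \<in> {i \<in> {1..d}. \<forall>c\<in>T. c i \<noteq> []}"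
    by (auto simp: push_def)
  moreover from this have "T \<noteq> {\<lambda>_. []}" by auto
  ultimately show ?thesis by blast
qed simp

lemma decs_gf_equation:
  assumes "2 \<le> p"
  shows "(\<Sum>k\<le>d. fps_const ((-1) ^ k * real (d choose k)) * decs_gf d p {} ^ (p ^ k)) = fps_X"
proof -
  have "(\<Sum>J\<in>Pow {1..d}. fps_const ((-1) ^ card J) * decs_gf d p J) = fps_X"
  proof (rule fps_ext)
    fix n
    let ?W = "{T \<in> decs d p. card T = n}"
    let ?I = "\<lambda>T. {i \<in> {1..d}. \<forall>c\<in>T. c i \<noteq> []}"
    have fin: "finite ?W" using finite_decs[OF assms] .
    \<comment> \<open>A decomposition \<open>T\<close> is counted for exactly those \<open>J\<close>
      contained in \<open>?I T\<close>; after exchanging the sums, its signed contributions cancel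
      unless \<open>?I T\<close> is empty.\<close>
    have "(\<Sum>J\<in>Pow {1..d}. fps_const ((-1) ^ card J) * decs_gf d p J) $ n =
      (\<Sum>J\<in>Pow {1..d}. \<Sum>T\<in>?W. if J \<subseteq> ?I T then (-1) ^ card J else 0)"
      unfolding fps_sum_nth
    proof (rule sum.cong)
      fix J assume J: "J \<in> Pow {1..d}"
      have "{T \<in> decs_through d p J. card T = n} = {T \<in> ?W. J \<subseteq> ?I T}"
        using J by (auto simp: decs_through_def)
      then show "(fps_const ((-1) ^ card J) * decs_gf d p J) $ n =
        (\<Sum>T\<in>?W. if J \<subseteq> ?I T then (-1) ^ card J else 0)"
        using fin by (simp add: decs_gf_def sum.If_cases Int_def)
    qed simp
    also have "\<dots> = (\<Sum>T\<in>?W. \<Sum>J\<in>Pow {1..d}. if J \<subseteq> ?I T then (-1) ^ card J else 0)"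
      by (rule sum.swap)
    also have "\<dots> = (\<Sum>T\<in>?W. if T = {\<lambda>_. []} then 1 else 0)"
    proof (rule sum.cong)
      fix T assume T: "T \<in> ?W"
      have "(\<Sum>J\<in>Pow {1..d}. if J \<subseteq> ?I T then (-1) ^ card J else 0 :: real) =
          (\<Sum>J\<in>Pow (?I T). (-1) ^ card J)"
        by (rule sum.mono_neutral_cong_right) auto
      also have "\<dots> = (if T = {\<lambda>_. []} then 1 else 0)"
        using alternating_sum_Pow[of "?I T"] decs_avoid_all_slabs[of T d p] T by auto
      finally show "(\<Sum>J\<in>Pow {1..d}. if J \<subseteq> ?I T then (-1) ^ card J else 0 :: real) =
          (if T = {\<lambda>_. []} then 1 else 0)" .
    qed simp
    \<comment> \<open>The surviving undivided cube has one cell, so it contributes only for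
      \<open>n = 1\<close>.\<close>
    also have "\<dots> = fps_X $ n"
      using fin decs.root[of d p] by (auto simp: sum.delta)
    finally show "(\<Sum>J\<in>Pow {1..d}. fps_const ((-1) ^ card J) * decs_gf d p J) $ n = fps_X $ n" .
  qed
  moreover have "(\<Sum>J\<in>Pow {1..d}. fps_const ((-1) ^ card J) * decs_gf d p J) =
    (\<Sum>k\<le>d. \<Sum>J\<in>{J \<in> Pow {1..d}. card J = k}. fps_const ((-1) ^ card J) * decs_gf d p J)"
    using card_mono[of "{1..d}"] by (intro sum.group[symmetric]) auto
  moreover have "\<dots> = (\<Sum>k\<le>d. fps_const ((-1) ^ k * real (d choose k)) * decs_gf d p {} ^ (p ^ k))"
  proof (rule sum.cong)
    fix k
    have "(\<Sum>J\<in>{J \<in> Pow {1..d}. card J = k}. fps_const ((-1) ^ card J) * decs_gf d p J) =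
      (\<Sum>J\<in>{J \<in> Pow {1..d}. card J = k}. fps_const ((-1) ^ k) * decs_gf d p {} ^ (p ^ k))"
    proof (rule sum.cong)
      fix J assume "J \<in> {J \<in> Pow {1..d}. card J = k}"
      then show "fps_const ((-1) ^ card J) * decs_gf d p J =
          fps_const ((-1) ^ k) * decs_gf d p {} ^ (p ^ k)"
        using decs_gf_eq_power[of J d p] assms by auto
    qed simp
    also have "\<dots> = of_nat (d choose k) * (fps_const ((-1) ^ k) * decs_gf d p {} ^ (p ^ k))"
      using n_subsets[of "{1..d}" k] by simp
    also have "\<dots> = fps_const ((-1) ^ k * real (d choose k)) * decs_gf d p {} ^ (p ^ k)"
      unfolding fps_of_nat[symmetric] mult.assoc[symmetric] fps_const_mult
      by (simp only: mult.commute)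
    finally show "(\<Sum>J\<in>{J \<in> Pow {1..d}. card J = k}. fps_const ((-1) ^ card J) * decs_gf d p J) =
        fps_const ((-1) ^ k * real (d choose k)) * decs_gf d p {} ^ (p ^ k)" .
  qed simp
  ultimately show ?thesis by simp
qed

subsection \<open>Lagrange inversion and negative powers\<close>

text \<open>Multiply \<open>g'(f) f' = 1\<close> by \<open>\<phi> ^ n\<close> and expand \<open>g'\<close>: among the products
  \<open>f ^ i f' \<phi> ^ n\<close> only the one with \<open>i = n - 1\<close> contributes to the coefficient of \<open>X ^ (n - 1)\<close>,
  because the others are derivatives of Laurent series up to a power of \<open>X\<close>.\<close>

lemma lagrange_inversion:
  fixes f g \<phi> :: "'a :: field_char_0 fps"
  assumes f: "f * \<phi> = fps_X" and g: "f oo g = fps_X" "g $ 0 = 0" and n: "n \<ge> 1"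
  shows "of_nat n * g $ n = (\<phi> ^ n) $ (n - 1)"
proof -
  have \<phi>0: "\<phi> $ 0 \<noteq> 0"
  proof
    assume 0: "\<phi> $ 0 = 0"
    have "(f oo g) $ 0 = f $ 0" by simp
    then have "f $ 0 = 0" using g by simp
    then have "(f * \<phi>) $ 1 = 0"
      using 0 by (simp add: fps_mult_nth)
    then show False using f by simp
  qed
  define \<psi> where "\<psi> = inverse \<phi>"
  have inv: "\<psi> * \<phi> = 1"
    unfolding \<psi>_def using \<phi>0 by (rule inverse_mult_eq_1)
  have f_eq: "f = fps_X * \<psi>"
    using f inv by (metis mult.assoc mult.commute mult_1)
  have f0: "f $ 0 = 0" and f1: "f $ 1 \<noteq> 0"
    using \<phi>0 by (simp_all add: f_eq \<psi>_def)
  \<comment> \<open>The right inverse \<open>g\<close> is identified with the two-sided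
    compositional inverse, which allows differentiating \<open>g oo f = fps_X\<close>.\<close>
  have "g = fps_inv f"
  proof -
    have "fps_inv f oo (f oo g) = (fps_inv f oo f) oo g"
      using f0 g(2) by (simp add: fps_compose_assoc)
    then show ?thesis
      using fps_inv[OF f0 f1] g by simp
  qed
  then have "g oo f = fps_X"
    using fps_inv[OF f0 f1] by simp
  then have deriv: "(fps_deriv g oo f) * fps_deriv f = 1"
    using fps_compose_deriv[OF f0, of g] by simp
  \<comment> \<open>Powers \<open>f ^ i\<close> with \<open>i \<ge> n\<close> start beyond
    \<open>X ^ (n - 1)\<close>, so this finite truncation suffices.\<close>
  define h where "h = (\<Sum>i<n. fps_const (fps_deriv g $ i) * f ^ i)"
  have h: "(fps_deriv g oo f) $ j = h $ j" if "j < n" for j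
  proof -
    have "h $ j = (\<Sum>i<n. fps_deriv g $ i * (f ^ i) $ j)"
      by (simp add: h_def fps_sum_nth)
    also have "\<dots> = (\<Sum>i\<in>{0..j}. fps_deriv g $ i * (f ^ i) $ j)"
      using that startsby_zero_power_prefix[OF f0]
      by (intro sum.mono_neutral_right) auto
    finally show ?thesis
      by (simp add: fps_compose_nth)
  qed
  have power_deriv: "(f ^ i * (fps_deriv f * \<phi> ^ n)) $ (n - 1) = (if Suc i = n then 1 else 0)"
    if i: "i < n" for i
  proof -
    define m where "m = n - 1 - i"
    have n_eq: "n = Suc (i + m)"
      using i by (simp add: m_def)
    have df: "fps_deriv f = \<psi> + fps_X * fps_deriv \<psi>"
      by (simp add: f_eq)
    have d\<psi>: "fps_deriv \<psi> * \<phi> * \<phi> = - fps_deriv \<phi>"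
    proof -
      have "fps_deriv (\<psi> * \<phi>) = 0" by (simp add: inv)
      then have "\<psi> * fps_deriv \<phi> = - (fps_deriv \<psi> * \<phi>)"
        by (simp add: eq_neg_iff_add_eq_0)
      then have "fps_deriv \<psi> * \<phi> * \<phi> = - (\<psi> * fps_deriv \<phi>) * \<phi>"
        by simp
      also have "\<dots> = - (\<psi> * \<phi>) * fps_deriv \<phi>" by (simp add: ac_simps)
      finally show ?thesis by (simp add: inv)
    qed
    \<comment> \<open>Of the \<open>n\<close> factors \<open>\<phi>\<close>, \<open>i\<close> turn
      \<open>f ^ i\<close> into \<open>X ^ i\<close>, leaving \<open>Suc m\<close> of them.\<close>
    have "f ^ i * (fps_deriv f * \<phi> ^ n) =
        fps_X ^ i * (\<psi> * \<phi>) ^ i * (\<phi> ^ Suc m * fps_deriv f)"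
      by (simp add: f_eq n_eq power_mult_distrib power_add ac_simps)
    also have "\<dots> = fps_X ^ i * (\<phi> ^ Suc m * fps_deriv f)"
      by (simp add: inv)
    finally have eq: "f ^ i * (fps_deriv f * \<phi> ^ n) = fps_X ^ i * (\<phi> ^ Suc m * fps_deriv f)" .
    have "(f ^ i * (fps_deriv f * \<phi> ^ n)) $ (n - 1) = (\<phi> ^ Suc m * fps_deriv f) $ m"
      unfolding eq by (simp add: fps_X_power_mult_nth n_eq)
    also have "\<phi> ^ Suc m * fps_deriv f = \<phi> ^ m * (\<psi> * \<phi>) + fps_X * (\<phi> ^ Suc m * fps_deriv \<psi>)"
      unfolding df by (simp add: algebra_simps)
    also have "\<dots> $ m = (if m = 0 then 1 else 0)"
    proof (cases m)
      case (Suc k)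
      have "\<phi> ^ Suc m * fps_deriv \<psi> = \<phi> ^ k * (fps_deriv \<psi> * \<phi> * \<phi>)"
        by (simp add: Suc ac_simps)
      also have "\<dots> = - (\<phi> ^ k * fps_deriv \<phi>)"
        by (simp only: d\<psi> mult_minus_right)
      finally have *: "\<phi> ^ Suc m * fps_deriv \<psi> = - (\<phi> ^ k * fps_deriv \<phi>)" .
      \<comment> \<open>For \<open>m > 0\<close> the two summands cancel: compare coefficient
        \<open>k = m - 1\<close> of the derivative of \<open>\<phi> ^ m\<close> and divide by
        \<open>m\<close>, which is nonzero in characteristic 0.\<close>
      have "fps_deriv (\<phi> ^ m) = of_nat m * (\<phi> ^ k * fps_deriv \<phi>)"
        unfolding fps_deriv_power' by (simp add: Suc ac_simps)
      then have "of_nat m * (\<phi> ^ k * fps_deriv \<phi>) $ k = of_nat m * (\<phi> ^ m) $ m"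
        by (metis Suc fps_deriv_nth fps_mult_of_nat_nth(1) add.commute plus_1_eq_Suc)
      then have "(\<phi> ^ k * fps_deriv \<phi>) $ k = (\<phi> ^ m) $ m"
        by (simp add: Suc del: of_nat_Suc)
      then show ?thesis
        using * by (simp add: inv Suc)
    qed (simp add: inv)
    also have "(if m = 0 then 1 else 0) = (if Suc i = n then 1 else (0::'a))"
      by (simp add: n_eq)
    finally show ?thesis .
  qed
  have "(\<phi> ^ n) $ (n - 1) = ((fps_deriv g oo f) * (fps_deriv f * \<phi> ^ n)) $ (n - 1)"
    by (simp only: mult.assoc[symmetric] deriv mult_1)
  also have "\<dots> = (h * (fps_deriv f * \<phi> ^ n)) $ (n - 1)"
    unfolding fps_mult_nth[of "fps_deriv g oo f"] fps_mult_nth[of h]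
    using h n by (intro sum.cong) auto
  also have "\<dots> = (\<Sum>i<n. fps_deriv g $ i * (f ^ i * (fps_deriv f * \<phi> ^ n)) $ (n - 1))"
    by (simp add: h_def sum_distrib_right fps_sum_nth mult.assoc)
  also have "\<dots> = (\<Sum>i<n. if i = n - 1 then fps_deriv g $ i else 0)"
  proof (rule sum.cong)
    fix i assume "i \<in> {..<n}"
    then show "fps_deriv g $ i * (f ^ i * (fps_deriv f * \<phi> ^ n)) $ (n - 1) =
        (if i = n - 1 then fps_deriv g $ i else 0)"
      using power_deriv[of i] n by (cases "Suc i = n") auto
  qed simp
  also have "\<dots> = of_nat n * g $ n"
    using n by (simp add: fps_deriv_nth)
  finally show ?thesis ..
qed

section \<open>Multinomial expansion of negative powers\<close>

lemma inverse_one_minus_fps_X_power_nth: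
  "(inverse (1 - fps_X) ^ Suc m :: real fps) $ s = real ((m + s) choose s)"
proof -
  have "inverse (1 - fps_X :: real fps) ^ Suc m = inverse ((1 - fps_const 1 * fps_X) ^ Suc m)"
    by (subst fps_inverse_power) simp
  then show ?thesis
    using one_minus_const_fps_X_neg_power'[of "Suc m" "1 :: real"] by simp
qed

lemma inverse_one_minus_compose_power:
  fixes w :: "real fps"
  assumes "w $ 0 = 0"
  shows "inverse (1 - w) ^ Suc m = (inverse (1 - fps_X) ^ Suc m) oo w"
proof -
  have "inverse (1 - fps_X) oo w = inverse ((1 - fps_X) oo w)"
    using assms by (intro fps_inverse_compose) auto
  also have "(1 - fps_X) oo w = 1 - w"
    using assms by (simp add: fps_compose_sub_distrib fps_X_fps_compose_startby0)
  finally show ?thesis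
    using assms by (metis fps_compose_power)
qed

lemma finite_weighted_tuples:
  assumes "finite K" "\<And>k. k \<in> K \<Longrightarrow> 1 \<le> e k"
  shows "finite {t \<in> K \<rightarrow>\<^sub>E (UNIV :: nat set). (\<Sum>k\<in>K. t k * e k) = N}"
proof (rule finite_subset)
  show "{t \<in> K \<rightarrow>\<^sub>E UNIV. (\<Sum>k\<in>K. t k * e k) = N} \<subseteq> K \<rightarrow>\<^sub>E {..N}"
  proof
    fix t assume t: "t \<in> {t \<in> K \<rightarrow>\<^sub>E UNIV. (\<Sum>k\<in>K. t k * e k) = N}"
    have "t k \<le> N" if "k \<in> K" for k
    proof -
      have "t k \<le> t k * e k"
        using assms(2)[OF that] by simp
      also have "\<dots> \<le> (\<Sum>k\<in>K. t k * e k)"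
        using assms(1) that by (intro member_le_sum) auto
      finally show ?thesis
        using t by simp
    qed
    then show "t \<in> K \<rightarrow>\<^sub>E {..N}"
      using t by (auto simp: PiE_iff)
  qed
qed (auto intro: finite_PiE assms(1))

text \<open>Induction on the number of terms via \<open>1 - Y - c X^e = (1 - Y) * (1 - w)\<close>
  with \<open>w = c X^e / (1 - Y)\<close>. The term \<open>w ^ s\<close> raises the power of
  \<open>1 / (1 - Y)\<close> from \<open>m + 1\<close> to \<open>m + s + 1\<close>, so
  \<open>m\<close> must vary in the induction.\<close>

lemma inverse_one_minus_sum_power_nth:
  fixes c :: "'a \<Rightarrow> real" and e :: "'a \<Rightarrow> nat"
  assumes "finite K" "\<And>k. k \<in> K \<Longrightarrow> 1 \<le> e k"
  shows "(inverse (1 - (\<Sum>k\<in>K. fps_const (c k) * fps_X ^ e k)) ^ Suc m) $ N =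
    (\<Sum>t | t \<in> K \<rightarrow>\<^sub>E UNIV \<and> (\<Sum>k\<in>K. t k * e k) = N.
      fact (m + (\<Sum>k\<in>K. t k)) / (fact m * (\<Prod>k\<in>K. fact (t k))) * (\<Prod>k\<in>K. c k ^ t k))"
  using assms
proof (induction K arbitrary: m N)
  case empty
  have "{t. t = (\<lambda>_. undefined) \<and> 0 = N} = (if N = 0 then {\<lambda>_. undefined :: nat} else {})"
    by auto
  then show ?case
    by simp
next
  case (insert a K)
  define Y where "Y = (\<Sum>k\<in>K. fps_const (c k) * fps_X ^ e k)"
  define Z where "Z = inverse (1 - Y)"
  define w where "w = fps_const (c a) * fps_X ^ e a * Z"
  let ?B = "\<lambda>N. {t. t \<in> K \<rightarrow>\<^sub>E (UNIV :: nat set) \<and> (\<Sum>k\<in>K. t k * e k) = N}"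
  let ?S = "{s. s \<le> N \<and> s * e a \<le> N}"
  let ?h = "\<lambda>m t. fact (m + (\<Sum>k\<in>K. t k)) / (fact m * (\<Prod>k\<in>K. fact (t k))) * (\<Prod>k\<in>K. c k ^ t k)"
  have Y0: "Y $ 0 = 0"
    unfolding Y_def fps_sum_nth using insert.prems by (intro sum.neutral) fastforce
  have w0: "w $ 0 = 0"
    using insert.prems[of a] by (simp add: w_def)
  have Z: "(1 - Y) * Z = 1"
    unfolding Z_def using Y0 by (intro inverse_mult_eq_1') simp
  have "1 - (\<Sum>k\<in>insert a K. fps_const (c k) * fps_X ^ e k) = (1 - Y) * (1 - w)"
  proof -
    have "(1 - Y) * (1 - w) = 1 - Y - fps_const (c a) * fps_X ^ e a * ((1 - Y) * Z)"
      by (simp add: w_def algebra_simps)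
    then show ?thesis
      using insert.hyps by (simp add: Y_def[symmetric] Z)
  qed
  then have "inverse (1 - (\<Sum>k\<in>insert a K. fps_const (c k) * fps_X ^ e k)) ^ Suc m =
      Z ^ Suc m * inverse (1 - w) ^ Suc m"
    by (simp only: fps_inverse_mult power_mult_distrib Z_def)
  \<comment> \<open>As \<open>w\<close> has no constant term, powers \<open>w ^ s\<close> with
    \<open>s > N\<close> cannot contribute; one bound serves all coefficients involved.\<close>
  also have "\<dots> $ N = (Z ^ Suc m * (\<Sum>s\<le>N. fps_const (real ((m + s) choose s)) * w ^ s)) $ N"
    unfolding fps_mult_nth[of "Z ^ Suc m"]
  proof (rule sum.cong)
    fix i assume "i \<in> {0..N}"
    have "(inverse (1 - w) ^ Suc m) $ (N - i) =
        (\<Sum>s\<in>{0..N - i}. real ((m + s) choose s) * (w ^ s) $ (N - i))"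
      unfolding inverse_one_minus_compose_power[OF w0] fps_compose_nth
        inverse_one_minus_fps_X_power_nth ..
    also have "\<dots> = (\<Sum>s\<le>N. real ((m + s) choose s) * (w ^ s) $ (N - i))"
      using startsby_zero_power_prefix[OF w0] by (intro sum.mono_neutral_left) auto
    finally show "(Z ^ Suc m) $ i * (inverse (1 - w) ^ Suc m) $ (N - i) =
        (Z ^ Suc m) $ i * (\<Sum>s\<le>N. fps_const (real ((m + s) choose s)) * w ^ s) $ (N - i)"
      by (simp add: fps_sum_nth)
  qed simp
  also have "\<dots> = (\<Sum>s\<le>N. real ((m + s) choose s) * (Z ^ Suc m * w ^ s) $ N)"
    by (simp only: sum_distrib_left mult.left_commute[of "Z ^ Suc m"] fps_sum_nth
        fps_mult_left_const_nth)
  also have "\<dots> = (\<Sum>s\<le>N. if s * e a \<le> N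
      then real ((m + s) choose s) * c a ^ s * (Z ^ Suc (m + s)) $ (N - s * e a) else 0)"
  proof (rule sum.cong)
    fix s
    have "Z ^ Suc m * w ^ s = fps_const (c a ^ s) * (fps_X ^ (s * e a) * Z ^ Suc (m + s))"
      by (simp add: w_def power_mult_distrib power_add power_mult[symmetric] fps_const_power ac_simps)
    then show "real ((m + s) choose s) * (Z ^ Suc m * w ^ s) $ N = (if s * e a \<le> N
      then real ((m + s) choose s) * c a ^ s * (Z ^ Suc (m + s)) $ (N - s * e a) else 0)"
      by (simp add: fps_X_power_mult_nth del: power_Suc)
  qed simp
  also have "\<dots> = (\<Sum>s\<in>?S. real ((m + s) choose s) * c a ^ s * (Z ^ Suc (m + s)) $ (N - s * e a))"
    by (rule sum.mono_neutral_cong_right) auto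
  also have "\<dots> = (\<Sum>s\<in>?S. \<Sum>t\<in>?B (N - s * e a). real ((m + s) choose s) * c a ^ s * ?h (m + s) t)"
    using insert.IH insert.prems unfolding Z_def Y_def by (simp add: sum_distrib_left del: power_Suc)
  also have "\<dots> = (\<Sum>(s, t)\<in>(SIGMA s:?S. ?B (N - s * e a)).
      real ((m + s) choose s) * c a ^ s * ?h (m + s) t)"
    using finite_weighted_tuples[OF insert.hyps(1)] insert.prems by (intro sum.Sigma) auto
  also have "\<dots> = (\<Sum>t | t \<in> insert a K \<rightarrow>\<^sub>E UNIV \<and> (\<Sum>k\<in>insert a K. t k * e k) = N.
      fact (m + (\<Sum>k\<in>insert a K. t k)) / (fact m * (\<Prod>k\<in>insert a K. fact (t k))) *
      (\<Prod>k\<in>insert a K. c k ^ t k))"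
  \<comment> \<open>The pair \<open>(s, t)\<close> is the tuple with entry \<open>s\<close> at
    \<open>a\<close>; resetting that entry to \<open>undefined\<close> restores extensionality on
    \<open>K\<close>.\<close>
  proof (rule sum.reindex_bij_witness[where i = "\<lambda>t. (t a, t(a := undefined))"
        and j = "\<lambda>(s, t). t(a := s)"])
    fix x assume "x \<in> (SIGMA s:?S. ?B (N - s * e a))"
    then obtain s t where x: "x = (s, t)" "s * e a \<le> N" "t \<in> K \<rightarrow>\<^sub>E UNIV"
      "(\<Sum>k\<in>K. t k * e k) = N - s * e a"
      by auto
    let ?t = "t(a := s)"
    have upd: "(\<Sum>k\<in>K. ?t k * e k) = (\<Sum>k\<in>K. t k * e k)" "(\<Sum>k\<in>K. ?t k) = (\<Sum>k\<in>K. t k)"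
      "(\<Prod>k\<in>K. fact (?t k)) = (\<Prod>k\<in>K. fact (t k) :: real)"
      "(\<Prod>k\<in>K. c k ^ ?t k) = (\<Prod>k\<in>K. c k ^ t k)"
      using insert.hyps(2) by (auto intro!: sum.cong prod.cong)
    show "(case x of (s, t) \<Rightarrow> t(a := s)) \<in>
      {t. t \<in> insert a K \<rightarrow>\<^sub>E UNIV \<and> (\<Sum>k\<in>insert a K. t k * e k) = N}"
      using x insert.hyps by (auto simp: upd PiE_iff extensional_def simp del: fun_upd_apply)
        (auto simp: PiE_iff extensional_def)
    show "((case x of (s, t) \<Rightarrow> t(a := s)) a, (case x of (s, t) \<Rightarrow> t(a := s))(a := undefined)) = x"
      using x insert.hyps(2) by (auto simp: PiE_iff extensional_def fun_eq_iff)
    \<comment> \<open>The factorial \<open>fact (m + s)\<close> in the binomial coefficient cancels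
      against the denominator of the smaller multinomial coefficient.\<close>
    show "fact (m + (\<Sum>k\<in>insert a K. (case x of (s, t) \<Rightarrow> t(a := s)) k)) /
      (fact m * (\<Prod>k\<in>insert a K. fact ((case x of (s, t) \<Rightarrow> t(a := s)) k))) *
      (\<Prod>k\<in>insert a K. c k ^ (case x of (s, t) \<Rightarrow> t(a := s)) k) =
      (case x of (s, t) \<Rightarrow> real ((m + s) choose s) * c a ^ s * ?h (m + s) t)"
      unfolding x(1) prod.case sum.insert[OF insert.hyps] prod.insert[OF insert.hyps] upd
      by (simp add: binomial_fact add.assoc field_simps)
  next
    fix t assume t: "t \<in> {t. t \<in> insert a K \<rightarrow>\<^sub>E UNIV \<and> (\<Sum>k\<in>insert a K. t k * e k) = N}"
    have upd: "(\<Sum>k\<in>K. (t(a := undefined)) k * e k) = (\<Sum>k\<in>K. t k * e k)"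
      using insert.hyps(2) by (auto intro!: sum.cong)
    have "t a * e a + (\<Sum>k\<in>K. t k * e k) = N"
      using t insert.hyps by simp
    moreover have "t a \<le> t a * e a"
      using insert.prems[of a] by simp
    ultimately have "t a \<le> N" "t a * e a \<le> N" "(\<Sum>k\<in>K. t k * e k) = N - t a * e a"
      by linarith+
    moreover have "t(a := undefined) \<in> K \<rightarrow>\<^sub>E UNIV"
      using t by (auto simp: PiE_iff extensional_def)
    ultimately show "(t a, t(a := undefined)) \<in> (SIGMA s:?S. ?B (N - s * e a))"
      using upd by auto
    show "(case (t a, t(a := undefined)) of (s, t) \<Rightarrow> t(a := s)) = t"
      by simp
  qed
  finally show ?case .
qed

section \<open>From the functional equation to the explicit count\<close>

theorem proposition4:
  fixes d p n :: nat
  assumes "d \<ge> 1" and "p \<ge> 2" and "n \<ge> 1"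
  shows "real (num_decompositions d p n) =
    1 / real n *
    (\<Sum>t\<in>exponents d p n.
       multinomial d (n - 1) t *
       (\<Prod>k=1..d. (-1) ^ (t k * (k + 1)) * real (d choose k) ^ t k))"
proof -
  define g where "g = decs_gf d p {}"
  \<comment> \<open>The exponent \<open>k + 1\<close> absorbs the minus sign in
    \<open>f = fps_X * (1 - S)\<close>, so that Lagrange inversion applies with
    \<open>\<phi> = inverse (1 - S)\<close>.\<close>
  define c where "c k = (-1) ^ (k + 1) * real (d choose k)" for k
  define S where "S = (\<Sum>k\<in>{1..d}. fps_const (c k) * fps_X ^ (p ^ k - 1))"
  define f where "f = (\<Sum>k\<le>d. fps_const ((-1) ^ k * real (d choose k)) * fps_X ^ (p ^ k))"
  have ge1: "1 \<le> p ^ k - 1" if "k \<in> {1..d}" for k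
  proof -
    have "p ^ 1 \<le> p ^ k"
      using assms(2) that by (intro power_increasing) auto
    then show ?thesis
      using assms(2) by simp
  qed
  have S0: "S $ 0 = 0"
    unfolding S_def fps_sum_nth using ge1 by (intro sum.neutral) fastforce
  have f_eq: "f = fps_X * (1 - S)"
  proof -
    have "f = fps_X + (\<Sum>k\<in>{1..d}. fps_const ((-1) ^ k * real (d choose k)) * fps_X ^ (p ^ k))"
      unfolding f_def by (simp add: atMost_atLeast0 sum.atLeast_Suc_atMost[of 0])
    also have "(\<Sum>k\<in>{1..d}. fps_const ((-1) ^ k * real (d choose k)) * fps_X ^ (p ^ k)) =
        (\<Sum>k\<in>{1..d}. - (fps_X * (fps_const (c k) * fps_X ^ (p ^ k - 1))))"
    proof (rule sum.cong)
      fix k assume "k \<in> {1..d}"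
      have "fps_X ^ (p ^ k) = (fps_X * fps_X ^ (p ^ k - 1) :: real fps)"
        using assms(2) by (subst power_Suc[symmetric]) simp
      moreover have "fps_const ((-1) ^ k * real (d choose k)) = - fps_const (c k)"
        by (simp add: c_def)
      ultimately show "fps_const ((-1) ^ k * real (d choose k)) * fps_X ^ (p ^ k) =
          - (fps_X * (fps_const (c k) * fps_X ^ (p ^ k - 1)))"
        by (simp only: mult_minus_left mult_minus_right mult.left_commute)
    qed simp
    finally show ?thesis
      by (simp add: S_def sum_negf sum_distrib_left algebra_simps)
  qed
  have inv: "f * inverse (1 - S) = fps_X"
    unfolding f_eq mult.assoc using S0 by (subst inverse_mult_eq_1') auto
  \<comment> \<open>Every decomposition has at least one cell, so composing with \<open>g\<close> is
    legitimate.\<close>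
  have g0: "g $ 0 = 0"
  proof -
    have "{T \<in> decs_through d p {}. card T = 0} = {}"
      using decs_nonempty[of _ d p] decs_finite assms(2) by (fastforce simp: decs_through_def)
    then show ?thesis
      by (simp only: g_def decs_gf_def fps_nth_Abs_fps) simp
  qed
  have "f oo g = (\<Sum>k\<le>d. fps_const ((-1) ^ k * real (d choose k)) * g ^ (p ^ k))"
    unfolding f_def using g0
    by (simp add: fps_compose_sum_distrib fps_compose_mult_distrib fps_X_fps_compose_startby0
        flip: fps_compose_power del: fps_const_mult)
  then have fg: "f oo g = fps_X"
    using decs_gf_equation[OF assms(2), of d] by (simp add: g_def)
  have "real (num_decompositions d p n) = g $ n"
    using num_decompositions_eq[OF assms(2), of d n] by (simp add: g_def decs_gf_def decs_through_def)
  also have "\<dots> = 1 / real n * (real n * g $ n)"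
    using assms(3) by simp
  \<comment> \<open>The exponent \<open>n\<close> is written \<open>Suc (n - 1)\<close> to match the
    expansion of negative powers with \<open>m = n - 1\<close>, the first lower entry of the
    multinomial coefficient.\<close>
  also have "real n * g $ n = (inverse (1 - S) ^ Suc (n - 1)) $ (n - 1)"
    using lagrange_inversion[OF inv fg g0 assms(3)] assms(3) by simp
  also have "\<dots> = (\<Sum>t\<in>exponents d p n. multinomial d (n - 1) t *
       (\<Prod>k=1..d. (-1) ^ (t k * (k + 1)) * real (d choose k) ^ t k))"
  proof -
    have "(inverse (1 - S) ^ Suc (n - 1)) $ (n - 1) =
        (\<Sum>t | t \<in> {1..d} \<rightarrow>\<^sub>E UNIV \<and> (\<Sum>k=1..d. t k * (p ^ k - 1)) = n - 1.
          multinomial d (n - 1) t * (\<Prod>k=1..d. c k ^ t k))"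
      unfolding S_def multinomial_def
      by (rule inverse_one_minus_sum_power_nth) (use ge1 in auto)
    moreover have "c k ^ t k = (-1) ^ (t k * (k + 1)) * real (d choose k) ^ t k" for t k
      by (simp only: c_def power_mult_distrib power_mult[symmetric] mult.commute[of "k + 1"])
    ultimately show ?thesis
      by (simp only: exponents_def)
  qed
  finally show ?thesis .
qed

end
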